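(* Let $\Theta \subset \mathbb{R}^d$, the probability law $P$ on $\Theta$, the constant $\rho>0$, and two candidates $M_1, M_2$ with value functions $V_{M_1}, V_{M_2} : \Theta \to \mathbb{R}$ satisfy assumptions (A1), (A2), (A3) given in the context. Let $\lambda$ denote Lebesgue measure on $\mathbb{R}^d$, write $\Delta(\theta) = V_{M_1}(\theta) - V_{M_2}(\theta)$ for $\theta\in\Theta$, and let $D = \{\theta \in \Theta : \Delta(\theta) \neq 0\}$. Then exactly one of the following holds. (i) $\lambda(D) = 0$: the two candidates agree $P$-almost surely (i.e. $V_{M_1}(\theta)=V_{M_2}(\theta)$ for $P$-almost every $\theta$), so they deliver the same value on almost every instance, and any disagreement is confined to a Lebesgue-null set. (ii) $\lambda(D) > 0$: then $p := P(D) \ge \rho\,\lambda(D) > 0$, and for i.i.d. draws $\theta_1, \dots, \theta_m \sim P$, $$\Pr\bigl[\Delta(\theta_j) = 0 \text{ for all } j \le m\bigr] = (1 - p)^m \le e^{-pm}.$$ Moreover, for any tolerance $\varepsilon > 0$, let $D_\varepsilon = \{\theta\in\Theta : |\Delta(\theta)| > \varepsilon\}$. If $\lambda(D_\varepsilon) > 0$, then the same bound holds with $D$ replaced by $D_\varepsilon$: $p_\varepsilon := P(D_\varepsilon) \ge \rho\,\lambda(D_\varepsilon) > 0$ and $\Pr[|\Delta(\theta_j)| \le \varepsilon \text{ for all } j \le m] = (1-p_\varepsilon)^m \le e^{-p_\varepsilon m}$. If $\lambda(D_\varepsilon) = 0$, the two candidates are indistinguishable at tolerance $\varepsilon$ and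 no amount of resampling separates them: for every $m$, i.i.d. draws $\theta_1,\dots,\theta_m\sim P$ satisfy $|\Delta(\theta_j)|\le\varepsilon$ for all $j\le m$ with probability one.
   Context: A candidate $M$ is a parametric (mixed-integer) linear program whose optimal value, as a function of a parameter $\theta \in \Theta$, is its value function $V_M$. (A1) The perturbation domain $\Theta \subset \mathbb{R}^d$ is compact and full-dimensional, and the resampling law $P$ on $\Theta$ has a density (with respect to Lebesgue measure $\lambda$) bounded below on $\Theta$ by a constant $\rho > 0$. (A2) For each candidate $M$ and each $\theta\in\Theta$, $$V_M(\theta) = \min_{x \in X_M} c_M(\theta)^\top x \quad \text{subject to } A_M x \le b_M(\theta),$$ where $c_M(\cdot)$ and $b_M(\cdot)$ are affine in $\theta$, the constraint matrix $A_M$ does not depend on $\theta$, and $X_M$ imposes integrality on a (fixed, possibly empty) subset of the coordinates of $x$. (A3) Over $\Theta$, each candidate has finitely many optimal integer patterns (an integer pattern is an assignment of values to the integer-constrained coordinates; that is, there is a finite set of integer patterns such that for every $\theta\in\Theta$ the minimum is attained by an $x$ whose integer coordinates form one of these patterns), and $V_M$ is finite on $\Theta$. *)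

theory Defs
  imports "HOL-Probability.Probability"
begin

text \<open>
  Parameters live in \<open>real ^ 'd\<close>, decision vectors in \<open>real ^ 'n\<close>, and the constraint rows are
  indexed by \<open>'m\<close>. The constraint matrix and the set of integer coordinates carry no parameter.
\<close>

record ('d, 'n, 'm) candidate =
  cost_vec :: "real ^ 'd \<Rightarrow> real ^ 'n"
  con_mat :: "real ^ 'n ^ 'm"
  rhs_vec :: "real ^ 'd \<Rightarrow> real ^ 'm"
  int_coords :: "'n set"

definition affine_map :: "('a::real_vector \<Rightarrow> 'b::real_vector) \<Rightarrow> bool" where
  "affine_map g \<longleftrightarrow> (\<exists>L v. linear L \<and> (\<forall>x. g x = L x + v))"

definition affine_data :: "('d::finite, 'n::finite, 'm::finite) candidate \<Rightarrow> bool" where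
  "affine_data M \<longleftrightarrow> affine_map (cost_vec M) \<and> affine_map (rhs_vec M)"

definition feasible ::
  "('d::finite, 'n::finite, 'm::finite) candidate \<Rightarrow> real ^ 'd \<Rightarrow> (real ^ 'n) set" where
  "feasible M \<theta> = {x. (\<forall>i\<in>int_coords M. x $ i \<in> \<int>) \<and> con_mat M *v x \<le> rhs_vec M \<theta>}"

definition objective ::
  "('d::finite, 'n::finite, 'm::finite) candidate \<Rightarrow> real ^ 'd \<Rightarrow> real ^ 'n \<Rightarrow> real" where
  "objective M \<theta> x = cost_vec M \<theta> \<bullet> x"

definition optimal ::
  "('d::finite, 'n::finite, 'm::finite) candidate \<Rightarrow> real ^ 'd \<Rightarrow> real ^ 'n \<Rightarrow> bool" where
  "optimal M \<theta> = is_arg_min (objective M \<theta>) (\<lambda>x. x \<in> feasible M \<theta>)"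

text \<open>
  The optimal value is extended-real valued (\<open>\<infinity>\<close> when infeasible, \<open>-\<infinity>\<close> when unbounded), so
  that finiteness is a genuine condition. It is the minimum whenever an optimal point exists.
\<close>

definition opt_value ::
  "('d::finite, 'n::finite, 'm::finite) candidate \<Rightarrow> real ^ 'd \<Rightarrow> ereal" where
  "opt_value M \<theta> = (INF x\<in>feasible M \<theta>. ereal (objective M \<theta> x))"

definition value_fun ::
  "('d::finite, 'n::finite, 'm::finite) candidate \<Rightarrow> real ^ 'd \<Rightarrow> real" where
  "value_fun M \<theta> = real_of_ereal (opt_value M \<theta>)"

definition integer_pattern ::
  "('d::finite, 'n::finite, 'm::finite) candidate \<Rightarrow> real ^ 'n \<Rightarrow> ('n \<Rightarrow> real)" where
  "integer_pattern M x = restrict (\<lambda>i. x $ i) (int_coords M)"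

definition finite_optimal_patterns ::
  "(real ^ 'd) set \<Rightarrow> ('d::finite, 'n::finite, 'm::finite) candidate \<Rightarrow> bool" where
  "finite_optimal_patterns \<Theta> M \<longleftrightarrow>
     (\<exists>Z. finite Z \<and> (\<forall>\<theta>\<in>\<Theta>. \<exists>x. optimal M \<theta> x \<and> integer_pattern M x \<in> Z))"

definition finite_value_on ::
  "(real ^ 'd) set \<Rightarrow> ('d::finite, 'n::finite, 'm::finite) candidate \<Rightarrow> bool" where
  "finite_value_on \<Theta> M \<longleftrightarrow> (\<forall>\<theta>\<in>\<Theta>. \<bar>opt_value M \<theta>\<bar> \<noteq> \<infinity>)"

definition full_dim_compact :: "(real ^ 'd::finite) set \<Rightarrow> bool" where
  "full_dim_compact \<Theta> \<longleftrightarrow> compact \<Theta> \<and> aff_dim \<Theta> = int CARD('d)"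

text \<open>
  The law is a measure whose underlying space is \<open>\<Theta>\<close> itself, with its Borel subsets. Hence
  every random variable with values in it lies in \<open>\<Theta>\<close> surely, and value functions are never
  evaluated outside \<open>\<Theta>\<close>.
\<close>

definition resampling_law ::
  "(real ^ 'd::finite) set \<Rightarrow> (real ^ 'd) measure \<Rightarrow> real \<Rightarrow> bool" where
  "resampling_law \<Theta> P \<rho> \<longleftrightarrow> prob_space P \<and> 0 < \<rho> \<and>
     (\<exists>f \<in> borel_measurable (restrict_space lborel \<Theta>).
        P = density (restrict_space lborel \<Theta>) (\<lambda>\<theta>. ennreal (f \<theta>)) \<and> (\<forall>\<theta>\<in>\<Theta>. \<rho> \<le> f \<theta>))"

definition iid_draws :: "'w measure \<Rightarrow> 'a measure \<Rightarrow> nat \<Rightarrow> (nat \<Rightarrow> 'w \<Rightarrow> 'a) \<Rightarrow> bool" where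
  "iid_draws \<Omega> P m X \<longleftrightarrow> prob_space \<Omega> \<and>
     prob_space.indep_vars \<Omega> (\<lambda>_. P) X {1..m} \<and> (\<forall>j\<in>{1..m}. distr \<Omega> P (X j) = P)"

definition value_gap ::
  "('d::finite, 'n1::finite, 'm1::finite) candidate \<Rightarrow> ('d, 'n2::finite, 'm2::finite) candidate
     \<Rightarrow> real ^ 'd \<Rightarrow> real" where
  "value_gap M1 M2 \<theta> = value_fun M1 \<theta> - value_fun M2 \<theta>"

definition disagreement ::
  "(real ^ 'd) set \<Rightarrow> ('d::finite, 'n1::finite, 'm1::finite) candidate
     \<Rightarrow> ('d, 'n2::finite, 'm2::finite) candidate \<Rightarrow> (real ^ 'd) set" where
  "disagreement \<Theta> M1 M2 = {\<theta>\<in>\<Theta>. value_gap M1 M2 \<theta> \<noteq> 0}"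

definition disagreement_beyond ::
  "real \<Rightarrow> (real ^ 'd) set \<Rightarrow> ('d::finite, 'n1::finite, 'm1::finite) candidate
     \<Rightarrow> ('d, 'n2::finite, 'm2::finite) candidate \<Rightarrow> (real ^ 'd) set" where
  "disagreement_beyond \<epsilon> \<Theta> M1 M2 = {\<theta>\<in>\<Theta>. \<bar>value_gap M1 M2 \<theta>\<bar> > \<epsilon>}"

end

theory Submission
  imports Defs
begin

text \<open>
  Since minima are attained, a sublevel set of a value function on \<open>\<Theta>\<close> is the projection of the
  closed set of pairs \<open>(\<theta>, x)\<close> with \<open>x\<close> feasible and of small objective. Cutting \<open>x\<close> down to balls
  of growing radius exhibits this projection as a countable union of compact sets, so value
  functions are Borel. Lower-boundedness of the density and independence then do the rest.
\<close>

section \<open>Attained minima and Borel measurability of value functions\<close>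

lemma continuous_on_affine_map:
  fixes g :: "'a::euclidean_space \<Rightarrow> 'b::real_normed_vector"
  assumes "affine_map g"
  shows "continuous_on S g"
proof -
  obtain L v where L: "linear L" and g: "\<And>x. g x = L x + v"
    using assms unfolding affine_map_def by blast
  have "continuous_on S (\<lambda>x. L x + v)"
    by (intro continuous_intros linear_continuous_on) (use L linear_conv_bounded_linear in blast)
  then show ?thesis
    using g by (metis (no_types, lifting) continuous_on_cong)
qed

text \<open>Attainment makes the extended-real infimum finite, so \<open>real_of_ereal\<close> never
  falls back on its default 0 at an infinity.\<close>

lemma value_fun_eq_objective:
  assumes "optimal M \<theta> x"
  shows "value_fun M \<theta> = objective M \<theta> x"
proof -
  have x: "x \<in> feasible M \<theta>" and min: "\<And>y. y \<in> feasible M \<theta> \<Longrightarrow> objective M \<theta> x \<le> objective M \<theta> y"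
    using assms unfolding optimal_def is_arg_min_linorder by auto
  have "opt_value M \<theta> = ereal (objective M \<theta> x)"
    unfolding opt_value_def
    by (rule antisym) (auto intro: INF_lower[OF x] INF_greatest simp: min)
  then show ?thesis
    by (simp add: value_fun_def)
qed

text \<open>An optimal point is itself the witness, even when \<open>t\<close> equals the optimal
  value; a bare infimum would only give witnesses for levels above it. This turns sublevel sets into
  projections.\<close>

lemma value_fun_le_iff:
  assumes "\<exists>x. optimal M \<theta> x"
  shows "value_fun M \<theta> \<le> t \<longleftrightarrow> (\<exists>x\<in>feasible M \<theta>. objective M \<theta> x \<le> t)"
proof -
  obtain x where x: "optimal M \<theta> x"
    using assms by blast
  then have "x \<in> feasible M \<theta>" "\<And>y. y \<in> feasible M \<theta> \<Longrightarrow> objective M \<theta> x \<le> objective M \<theta> y"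
    unfolding optimal_def is_arg_min_linorder by auto
  then show ?thesis
    using value_fun_eq_objective[OF x] by (metis order_trans)
qed

text \<open>Closedness is joint in parameter and decision: every condition is a weak inequality
  between continuous functions of the pair, or the preimage of the closed set \<open>\<int>\<close>
  under a coordinate. The product of the varying cost with \<open>x\<close> is still
  continuous.\<close>

lemma closed_sublevel_graph:
  fixes M :: "('d::finite, 'n::finite, 'm::finite) candidate"
  assumes "affine_data M"
  shows "closed {z. snd z \<in> feasible M (fst z) \<and> objective M (fst z) (snd z) \<le> t}"
proof -
  have c: "continuous_on UNIV (cost_vec M)" and b: "continuous_on UNIV (rhs_vec M)"
    using assms continuous_on_affine_map unfolding affine_data_def by blast+
  have c': "continuous_on UNIV (\<lambda>z::(real^'d) \<times> (real^'n). cost_vec M (fst z))"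
    and b': "continuous_on UNIV (\<lambda>z::(real^'d) \<times> (real^'n). rhs_vec M (fst z))"
    by (auto intro!: continuous_intros continuous_on_compose2[OF c] continuous_on_compose2[OF b])
  have m: "continuous_on UNIV (\<lambda>z::(real^'d) \<times> (real^'n). con_mat M *v snd z)"
    by (intro continuous_on_compose2[OF linear_continuous_on[OF matrix_vector_mul_bounded_linear]]
        continuous_intros) auto
  have int: "closed ((\<lambda>z::(real^'d) \<times> (real^'n). snd z $ i) -` \<int>)" for i
    by (intro continuous_closed_vimage closed_Ints) (auto intro!: continuous_intros)
  have con: "closed {z::(real^'d) \<times> (real^'n). (con_mat M *v snd z) $ k \<le> rhs_vec M (fst z) $ k}" for k
    by (intro closed_Collect_le continuous_on_component m b')
  have obj: "closed {z::(real^'d) \<times> (real^'n). cost_vec M (fst z) \<bullet> snd z \<le> t}"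
    by (intro closed_Collect_le continuous_intros c')
  have "{z. snd z \<in> feasible M (fst z) \<and> objective M (fst z) (snd z) \<le> t} =
      (\<Inter>i\<in>int_coords M. (\<lambda>z. snd z $ i) -` \<int>) \<inter>
      (\<Inter>k. {z. (con_mat M *v snd z) $ k \<le> rhs_vec M (fst z) $ k}) \<inter>
      {z. cost_vec M (fst z) \<bullet> snd z \<le> t}"
    by (auto simp: feasible_def objective_def less_eq_vec_def)
  then show ?thesis
    using int con obj by (simp add: closed_Int closed_INT)
qed

lemma value_fun_sublevel_borel:
  fixes M :: "('d::finite, 'n::finite, 'm::finite) candidate"
  assumes "compact \<Theta>" "affine_data M" "\<And>\<theta>. \<theta> \<in> \<Theta> \<Longrightarrow> \<exists>x. optimal M \<theta> x"
  shows "{\<theta>\<in>\<Theta>. value_fun M \<theta> \<le> t} \<in> sets borel"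
proof -
  define G where "G = {z. snd z \<in> feasible M (fst z) \<and> objective M (fst z) (snd z) \<le> t}"
  \<comment> \<open>The projection of a closed set along the unbounded variable \<open>x\<close>
    need not be closed. Each truncation is compact, and so is its continuous image.\<close>
  define K where "K k = fst ` ((\<Theta> \<times> cball 0 (real k)) \<inter> G)" for k :: nat
  have "compact (K k)" for k
    unfolding K_def G_def
    by (intro compact_continuous_image compact_Int_closed compact_Times assms compact_cball
        closed_sublevel_graph continuous_intros)
  then have "K k \<in> sets borel" for k
    using borel_compact by blast
  moreover have "{\<theta>\<in>\<Theta>. value_fun M \<theta> \<le> t} = (\<Union>k. K k)"
  proof (intro equalityI subsetI)
    fix \<theta> assume "\<theta> \<in> {\<theta>\<in>\<Theta>. value_fun M \<theta> \<le> t}"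
    then obtain x where "\<theta> \<in> \<Theta>" "x \<in> feasible M \<theta>" "objective M \<theta> x \<le> t"
      using value_fun_le_iff assms(3) by blast
    moreover obtain k :: nat where "norm x \<le> real k"
      using real_arch_simple by blast
    ultimately have "(\<theta>, x) \<in> (\<Theta> \<times> cball 0 (real k)) \<inter> G"
      by (auto simp: G_def)
    then show "\<theta> \<in> (\<Union>k. K k)"
      unfolding K_def by force
  next
    fix \<theta> assume "\<theta> \<in> (\<Union>k. K k)"
    then obtain x where "\<theta> \<in> \<Theta>" "x \<in> feasible M \<theta>" "objective M \<theta> x \<le> t"
      by (auto simp: K_def G_def)
    then show "\<theta> \<in> {\<theta>\<in>\<Theta>. value_fun M \<theta> \<le> t}"
      using value_fun_le_iff assms(3) by blast
  qed
  ultimately show ?thesis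
    by auto
qed

text \<open>Measurability is relative to \<Theta>, since minima are known to be attained only
  there.\<close>

lemma value_fun_borel_measurable:
  fixes M :: "('d::finite, 'n::finite, 'm::finite) candidate"
  assumes "compact \<Theta>" "affine_data M" "finite_optimal_patterns \<Theta> M"
  shows "value_fun M \<in> borel_measurable (restrict_space borel \<Theta>)"
proof (subst borel_measurable_iff_le, intro allI)
  fix t
  have "{\<theta>\<in>\<Theta>. value_fun M \<theta> \<le> t} \<in> sets borel"
    \<comment> \<open>\<open>finite_optimal_patterns\<close> supplies an optimal point at every
      parameter of \<Theta>.\<close>
    using assms by (intro value_fun_sublevel_borel) (auto simp: finite_optimal_patterns_def)
  then show "{\<theta> \<in> space (restrict_space borel \<Theta>). value_fun M \<theta> \<le> t} \<in> sets (restrict_space borel \<Theta>)"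
    using borel_compact[OF assms(1)]
    by (auto simp: sets_restrict_space_iff space_restrict_space)
qed

section \<open>The resampling law compared with Lebesgue measure\<close>

lemma resampling_law_sets:
  assumes "resampling_law \<Theta> P \<rho>"
  shows "sets P = sets (restrict_space borel \<Theta>)" "space P = \<Theta>"
proof -
  show *: "sets P = sets (restrict_space borel \<Theta>)"
    using assms unfolding resampling_law_def by (auto simp: sets_restrict_space)
  show "space P = \<Theta>"
    using sets_eq_imp_space_eq[OF *] by (simp add: space_restrict_space)
qed

text \<open>Integrate the pointwise bound \<open>\<rho> \<le> f\<close> over
  \<open>E\<close>.\<close>

lemma resampling_law_ge_lborel:
  assumes law: "resampling_law \<Theta> P \<rho>" and "\<Theta> \<in> sets borel" "bounded \<Theta>"
    and E: "E \<in> sets borel" "E \<subseteq> \<Theta>"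
  shows "\<rho> * measure lborel E \<le> measure P E"
proof -
  obtain f where f: "f \<in> borel_measurable (restrict_space lborel \<Theta>)"
    and P: "P = density (restrict_space lborel \<Theta>) (\<lambda>\<theta>. ennreal (f \<theta>))"
    and \<rho>: "\<forall>\<theta>\<in>\<Theta>. \<rho> \<le> f \<theta>" "0 < \<rho>" and "prob_space P"
    using law unfolding resampling_law_def by blast
  interpret prob_space P by fact
  let ?R = "restrict_space lborel \<Theta>"
  have ER: "E \<in> sets ?R"
    using assms by (auto simp: sets_restrict_space_iff)
  \<comment> \<open>Finiteness lets the real-valued \<open>measure\<close> stand for
    \<open>emeasure\<close>; on sets of infinite measure it would return 0.\<close>
  have "emeasure lborel E < \<infinity>"
    using E(2) \<open>bounded \<Theta>\<close> by (intro emeasure_bounded_finite) (rule bounded_subset)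
  then have "ennreal (\<rho> * measure lborel E) = ennreal \<rho> * emeasure lborel E"
    using \<rho> by (simp add: ennreal_mult emeasure_eq_ennreal_measure)
  also have "\<dots> = ennreal \<rho> * emeasure ?R E"
    using assms by (simp add: emeasure_restrict_space)
  also have "\<dots> = (\<integral>\<^sup>+\<theta>. ennreal \<rho> * indicator E \<theta> \<partial>?R)"
    using ER by (simp add: nn_integral_cmult_indicator)
  also have "\<dots> \<le> (\<integral>\<^sup>+\<theta>. ennreal (f \<theta>) * indicator E \<theta> \<partial>?R)"
    using \<rho> by (intro nn_integral_mono mult_right_mono ennreal_leI)
      (auto simp: space_restrict_space)
  also have "\<dots> = emeasure P E"
    unfolding P using ER f by (subst emeasure_density) auto
  finally show ?thesis
    by (simp add: emeasure_eq_measure)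
qed

text \<open>A law with a density is absolutely continuous; this carries Lebesgue-null disagreement
  over to \<open>P\<close>.\<close>

lemma resampling_law_null_sets:
  assumes law: "resampling_law \<Theta> P \<rho>" and "\<Theta> \<in> sets borel"
    and E: "E \<in> null_sets lborel" "E \<subseteq> \<Theta>"
  shows "E \<in> null_sets P"
proof -
  obtain f where f: "f \<in> borel_measurable (restrict_space lborel \<Theta>)"
    and P: "P = density (restrict_space lborel \<Theta>) (\<lambda>\<theta>. ennreal (f \<theta>))"
    using law unfolding resampling_law_def by blast
  have "E \<in> null_sets (restrict_space lborel \<Theta>)"
    using assms by (simp add: null_sets_restrict_space)
  \<comment> \<open>The criterion asks the density to vanish almost everywhere on \<open>E\<close>,
    which is vacuous because almost every point lies outside \<open>E\<close>.\<close>
  then show ?thesis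
    unfolding P using f AE_not_in[of E "restrict_space lborel \<Theta>"]
    by (subst null_sets_density_iff) (auto elim!: eventually_mono)
qed

text \<open>Boundedness rules out infinite measure, where \<open>measure\<close> would be 0 on a set
  that is not null.\<close>

lemma bounded_null_sets_lborel_iff:
  fixes E :: "'a::euclidean_space set"
  assumes "E \<in> sets borel" "bounded E"
  shows "E \<in> null_sets lborel \<longleftrightarrow> measure lborel E = 0"
proof -
  have "emeasure lborel E = ennreal (measure lborel E)"
    using emeasure_bounded_finite[OF assms(2)] by (intro emeasure_eq_ennreal_measure) simp
  then show ?thesis
    using assms(1) by (simp add: null_sets_def)
qed

section \<open>Events determined by finitely many independent draws\<close>

lemma iid_draws_avoid:
  assumes iid: "iid_draws \<Omega> P m X" and E: "E \<in> sets P"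
  shows "measure \<Omega> {\<omega> \<in> space \<Omega>. \<forall>j\<in>{1..m}. X j \<omega> \<notin> E} = (1 - measure P E) ^ m"
proof -
  interpret prob_space \<Omega>
    using iid unfolding iid_draws_def by blast
  have ind: "indep_vars (\<lambda>_. P) X {1..m}" and dist: "\<And>j. j \<in> {1..m} \<Longrightarrow> distr \<Omega> P (X j) = P"
    using iid unfolding iid_draws_def by auto
  have meas: "X j \<in> measurable \<Omega> P" if "j \<in> {1..m}" for j
    using ind that unfolding indep_vars_def by blast
  let ?A = "\<lambda>j. X j -` (space P - E) \<inter> space \<Omega>"
  have prob: "prob (?A j) = 1 - measure P E" if "j \<in> {1..m}" for j
  proof -
    \<comment> \<open>\<open>iid_draws\<close> says only that \<open>\<Omega>\<close> is a
      probability space; for \<open>P\<close> this follows because \<open>P\<close> is the law of a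
      draw.\<close>
    interpret P: prob_space P
      using prob_space_distr[OF meas[OF that]] dist[OF that] by simp
    have "prob (?A j) = measure (distr \<Omega> P (X j)) (space P - E)"
      using E meas[OF that] by (subst measure_distr) auto
    then show ?thesis
      using dist[OF that] P.prob_compl[OF E] by simp
  qed
  show ?thesis
  \<comment> \<open>The product formula for independent variables needs a nonempty index set, and
    the empty intersection would be \<open>UNIV\<close> rather than
    \<open>space \<Omega>\<close>.\<close>
  proof (cases "m = 0")
    case True
    then show ?thesis by (simp add: prob_space)
  next
    case False
    have "{\<omega> \<in> space \<Omega>. \<forall>j\<in>{1..m}. X j \<omega> \<notin> E} = (\<Inter>j\<in>{1..m}. ?A j)"
    proof (intro equalityI subsetI)
      fix \<omega> assume "\<omega> \<in> {\<omega> \<in> space \<Omega>. \<forall>j\<in>{1..m}. X j \<omega> \<notin> E}"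
      then show "\<omega> \<in> (\<Inter>j\<in>{1..m}. ?A j)"
        using measurable_space[OF meas] by simp
    next
      fix \<omega> assume "\<omega> \<in> (\<Inter>j\<in>{1..m}. ?A j)"
      \<comment> \<open>Some index is needed to read off membership in \<open>space \<Omega>\<close>
        from the intersection.\<close>
      moreover have "1 \<in> {1..m}"
        using False by simp
      ultimately show "\<omega> \<in> {\<omega> \<in> space \<Omega>. \<forall>j\<in>{1..m}. X j \<omega> \<notin> E}"
        by blast
    qed
    also have "prob \<dots> = (\<Prod>j\<in>{1..m}. prob (?A j))"
      using False E by (intro indep_varsD[OF ind]) auto
    also have "\<dots> = (1 - measure P E) ^ m"
      using prob by simp
    finally show ?thesis .
  qed
qed

text \<open>Each draw has law \<open>P\<close>, so the almost sure property pulls back along it, and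
  finitely many null sets have a null union.\<close>

lemma iid_draws_AE:
  assumes iid: "iid_draws \<Omega> P m X" and Q: "AE \<theta> in P. Q \<theta>"
  shows "AE \<omega> in \<Omega>. \<forall>j\<in>{1..m}. Q (X j \<omega>)"
proof (rule AE_finite_allI)
  interpret prob_space \<Omega>
    using iid unfolding iid_draws_def by blast
  fix j assume j: "j \<in> {1..m}"
  have "X j \<in> measurable \<Omega> P" "distr \<Omega> P (X j) = P"
    using iid j unfolding iid_draws_def indep_vars_def by auto
  then show "AE \<omega> in \<Omega>. Q (X j \<omega>)"
    using Q AE_distrD[of "X j" \<Omega> P Q] by metis
qed simp

text \<open>Raise \<open>1 - p \<le> exp (- p)\<close> to the power \<open>m\<close>; the assumption
  keeps the base nonnegative, so that powers are monotone.\<close>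

lemma one_minus_power_le_exp:
  fixes p :: real
  assumes "p \<le> 1"
  shows "(1 - p) ^ m \<le> exp (- p * real m)"
proof -
  have "(1 - p) ^ m \<le> exp (- p) ^ m"
    using assms exp_ge_add_one_self[of "- p"] by (intro power_mono) auto
  then show ?thesis
    by (simp add: exp_of_nat_mult[symmetric] mult.commute)
qed

text \<open>Abstracting agreement to a predicate \<open>Q\<close> lets exact equality and agreement
  up to a tolerance be two instances of one argument.\<close>

lemma iid_draws_detection:
  assumes law: "resampling_law \<Theta> P \<rho>" and "\<Theta> \<in> sets borel" "bounded \<Theta>"
    and E: "E \<in> sets borel" "E = {\<theta>\<in>\<Theta>. \<not> Q \<theta>}" "measure lborel E > 0"
  shows "measure P E \<ge> \<rho> * measure lborel E \<and> \<rho> * measure lborel E > 0 \<and>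
    (\<forall>(\<Omega> :: 'w measure) m X. iid_draws \<Omega> P m X \<longrightarrow>
       measure \<Omega> {\<omega> \<in> space \<Omega>. \<forall>j\<in>{1..m}. Q (X j \<omega>)} = (1 - measure P E) ^ m \<and>
       (1 - measure P E) ^ m \<le> exp (- measure P E * real m))"
proof (intro conjI allI impI)
  have sub: "E \<subseteq> \<Theta>"
    using E by auto
  show "\<rho> * measure lborel E \<le> measure P E"
    using assms sub by (intro resampling_law_ge_lborel)
  show "\<rho> * measure lborel E > 0"
    using law E by (simp add: resampling_law_def)
  interpret prob_space P
    using law unfolding resampling_law_def by blast
  fix \<Omega> :: "'w measure" and m X
  assume iid: "iid_draws \<Omega> P m X"
  have "E \<in> sets P"
    using assms sub by (auto simp: resampling_law_sets(1)[OF law] sets_restrict_space_iff)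
  \<comment> \<open>\<open>E\<close> records failures of \<open>Q\<close> inside \<Theta> only. The
    events coincide because draws take values in \<open>space P\<close>, which is \<Theta>.\<close>
  moreover have "{\<omega> \<in> space \<Omega>. \<forall>j\<in>{1..m}. Q (X j \<omega>)} = {\<omega> \<in> space \<Omega>. \<forall>j\<in>{1..m}. X j \<omega> \<notin> E}"
  proof -
    have "X j \<in> measurable \<Omega> P" if "j \<in> {1..m}" for j
      using iid that unfolding iid_draws_def
      by (auto simp: prob_space.indep_vars_def)
    then have "X j \<omega> \<in> \<Theta>" if "j \<in> {1..m}" "\<omega> \<in> space \<Omega>" for j \<omega>
      using that measurable_space resampling_law_sets(2)[OF law] by metis
    then show ?thesis
      unfolding E(2) by blast
  qed
  ultimately show "measure \<Omega> {\<omega> \<in> space \<Omega>. \<forall>j\<in>{1..m}. Q (X j \<omega>)} = (1 - measure P E) ^ m"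
    using iid_draws_avoid[OF iid] by simp
  show "(1 - measure P E) ^ m \<le> exp (- measure P E * real m)"
    by (intro one_minus_power_le_exp prob_le_1)
qed

text \<open>The null counterpart of \<open>iid_draws_detection\<close>: as \<open>space P\<close> is
  \<Theta>, every failure of \<open>Q\<close> visible to \<open>P\<close> lies in the null set
  \<open>E\<close>.\<close>

lemma resampling_law_AE:
  assumes law: "resampling_law \<Theta> P \<rho>" and "\<Theta> \<in> sets borel" "bounded \<Theta>"
    and E: "E \<in> sets borel" "E = {\<theta>\<in>\<Theta>. \<not> Q \<theta>}" "measure lborel E = 0"
  shows "AE \<theta> in P. Q \<theta>"
proof -
  have "E \<subseteq> \<Theta>"
    unfolding E(2) by blast
  then have "E \<in> null_sets lborel"
    using bounded_null_sets_lborel_iff[OF E(1)] bounded_subset[OF \<open>bounded \<Theta>\<close>] E(3) by simp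
  then have "E \<in> null_sets P"
    using \<open>E \<subseteq> \<Theta>\<close> by (rule resampling_law_null_sets[OF law \<open>\<Theta> \<in> sets borel\<close>])
  moreover have "{\<theta> \<in> space P. \<not> Q \<theta>} \<subseteq> E"
    unfolding E(2) resampling_law_sets(2)[OF law] ..
  ultimately show ?thesis
    by (rule AE_I')
qed

text \<open>Since \<open>measure\<close> is 0 on nonmeasurable sets and on sets of infinite measure,
  the conclusion also asserts that the disagreement sets are Borel and, in the first alternative,
  that \<open>D\<close> is a genuine null set.\<close>

theorem proposition1:
  fixes \<Theta> :: "(real ^ 'd::finite) set"
    and P :: "(real ^ 'd) measure"
    and \<rho> :: real
    and M1 :: "('d, 'n1::finite, 'm1::finite) candidate"
    and M2 :: "('d, 'n2::finite, 'm2::finite) candidate"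
  assumes "full_dim_compact \<Theta>" and "resampling_law \<Theta> P \<rho>"
    and "affine_data M1" and "affine_data M2"
    and "finite_optimal_patterns \<Theta> M1" and "finite_value_on \<Theta> M1"
    and "finite_optimal_patterns \<Theta> M2" and "finite_value_on \<Theta> M2"
  shows
    "let \<Delta> = value_gap M1 M2;
         D = disagreement \<Theta> M1 M2;
         p = measure P D;
         agree = (measure lborel D = 0 \<and> D \<in> null_sets lborel \<and>
                  (AE \<theta> in P. value_fun M1 \<theta> = value_fun M2 \<theta>));
         differ = (measure lborel D > 0 \<and> p \<ge> \<rho> * measure lborel D \<and> \<rho> * measure lborel D > 0 \<and>
                  (\<forall>(\<Omega> :: 'w measure) m X. iid_draws \<Omega> P m X \<longrightarrow>
                     measure \<Omega> {\<omega> \<in> space \<Omega>. \<forall>j\<in>{1..m}. \<Delta> (X j \<omega>) = 0} = (1 - p) ^ m \<and>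
                     (1 - p) ^ m \<le> exp (- p * real m)))
     in D \<in> sets borel \<and>
        (agree \<or> differ) \<and> \<not> (agree \<and> differ) \<and>
        (\<forall>\<epsilon>>0.
           let D\<epsilon> = disagreement_beyond \<epsilon> \<Theta> M1 M2;
               p\<epsilon> = measure P D\<epsilon>
           in D\<epsilon> \<in> sets borel \<and>
              (measure lborel D\<epsilon> > 0 \<longrightarrow>
                 p\<epsilon> \<ge> \<rho> * measure lborel D\<epsilon> \<and> \<rho> * measure lborel D\<epsilon> > 0 \<and>
                 (\<forall>(\<Omega> :: 'w measure) m X. iid_draws \<Omega> P m X \<longrightarrow>
                    measure \<Omega> {\<omega> \<in> space \<Omega>. \<forall>j\<in>{1..m}. \<bar>\<Delta> (X j \<omega>)\<bar> \<le> \<epsilon>} = (1 - p\<epsilon>) ^ m \<and>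
                    (1 - p\<epsilon>) ^ m \<le> exp (- p\<epsilon> * real m))) \<and>
              (measure lborel D\<epsilon> = 0 \<longrightarrow>
                 (AE \<theta> in P. \<bar>\<Delta> \<theta>\<bar> \<le> \<epsilon>) \<and>
                 (\<forall>(\<Omega> :: 'w measure) m X. iid_draws \<Omega> P m X \<longrightarrow>
                    (AE \<omega> in \<Omega>. \<forall>j\<in>{1..m}. \<bar>\<Delta> (X j \<omega>)\<bar> \<le> \<epsilon>))))"
proof -
  have "compact \<Theta>"
    using assms(1) by (simp add: full_dim_compact_def)
  then have \<Theta>: "\<Theta> \<in> sets borel" "bounded \<Theta>"
    by (auto intro: borel_compact compact_imp_bounded)
  have [measurable]: "value_gap M1 M2 \<in> borel_measurable (restrict_space borel \<Theta>)"
    unfolding value_gap_def[abs_def]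
    by (intro borel_measurable_diff value_fun_borel_measurable \<open>compact \<Theta>\<close> assms)
  \<comment> \<open>Relative measurability on \<Theta> becomes Borel measurability in the whole
    space because \<Theta> is itself Borel.\<close>
  have borel: "{\<theta>\<in>\<Theta>. value_gap M1 M2 \<theta> \<in> B} \<in> sets borel" if "B \<in> sets borel" for B
  proof -
    have "value_gap M1 M2 -` B \<inter> space (restrict_space borel \<Theta>) \<in> sets (restrict_space borel \<Theta>)"
      using that by measurable
    moreover have "value_gap M1 M2 -` B \<inter> space (restrict_space borel \<Theta>) = {\<theta>\<in>\<Theta>. value_gap M1 M2 \<theta> \<in> B}"
      by (auto simp: space_restrict_space)
    ultimately show ?thesis
      using \<Theta> by (auto simp: sets_restrict_space_iff)
  qed
  let ?D = "disagreement \<Theta> M1 M2"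
  have D: "?D \<in> sets borel"
    using borel[of "- {0}"] by (simp add: disagreement_def)
  have D_eq: "?D = {\<theta>\<in>\<Theta>. \<not> value_gap M1 M2 \<theta> = 0}"
    by (simp add: disagreement_def)
  have "bounded ?D"
    using bounded_subset[OF \<Theta>(2)] by (auto simp: D_eq)
  note D_null = bounded_null_sets_lborel_iff[OF D this]
  have D_AE: "AE \<theta> in P. value_fun M1 \<theta> = value_fun M2 \<theta>" if "measure lborel ?D = 0"
    using resampling_law_AE[OF assms(2) \<Theta> D D_eq that] by (simp add: value_gap_def)
  note D_pos = iid_draws_detection[OF assms(2) \<Theta> D D_eq]
  let ?De = "\<lambda>\<epsilon>. disagreement_beyond \<epsilon> \<Theta> M1 M2"
  have De: "?De \<epsilon> \<in> sets borel" for \<epsilon>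
    using borel[of "{x. \<bar>x\<bar> > \<epsilon>}"] by (simp add: disagreement_beyond_def)
  have De_eq: "?De \<epsilon> = {\<theta>\<in>\<Theta>. \<not> \<bar>value_gap M1 M2 \<theta>\<bar> \<le> \<epsilon>}" for \<epsilon>
    by (auto simp: disagreement_beyond_def)
  note De_AE = resampling_law_AE[OF assms(2) \<Theta> De De_eq]
  note De_pos = iid_draws_detection[OF assms(2) \<Theta> De De_eq]
  show ?thesis
    unfolding Let_def
  \<comment> \<open>Goals 1 to 3 concern \<open>D\<close>: measurability, existence of an
    alternative, and exclusivity, which holds as a measure is not both zero and positive. Goals 4 to
    10 fix \<epsilon>: measurability, then the positive case (5 to 8) and the null case (9 and
    10).\<close>
  proof (intro conjI allI impI, goal_cases)
    case 1
    show ?case by (fact D)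
  next
    case 2
    show ?case
    proof (cases "measure lborel ?D = 0")
      case True
      then show ?thesis using D_null D_AE by blast
    next
      case False
      then have pos: "measure lborel ?D > 0"
        by (simp add: zero_less_measure_iff)
      show ?thesis
        by (intro disjI2 conjI[OF pos] D_pos[OF pos])
    qed
  next
    case 3
    show ?case by auto
  next
    case (4 \<epsilon>)
    show ?case by (fact De)
  next
    case (5 \<epsilon>)
    then show ?case using De_pos by blast
  next
    case (6 \<epsilon>)
    then show ?case using De_pos by blast
  next
    case (7 \<epsilon> \<Omega> m X)
    then show ?case using De_pos by blast
  next
    case (8 \<epsilon> \<Omega> m X)
    then show ?case using De_pos by blast
  next
    case (9 \<epsilon>)
    then show ?case using De_AE by blast
  next
    case (10 \<epsilon> \<Omega> m X)
    then show ?case using iid_draws_AE[OF 10(3) De_AE] by blast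
  qed
qed

end
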